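(* Consider the qubit prepare-transform-measure game described in the context. For every strategy (arbitrary qubit states of Alice, arbitrary two-outcome qubit instruments of Bob, arbitrary two-outcome qubit POVMs of Charlie, and arbitrary shared classical randomness), the average guessing probabilities $\bar P_{\mathrm{Bob}}$ of Bob and $\bar P_{\mathrm{Charlie}}$ of Charlie satisfy the trade-off relation $$\bar P_{\mathrm{Charlie}}\le\frac12+\frac{1}{4\sqrt2}+\frac{\sqrt{16\,\bar P_{\mathrm{Bob}}(1-\bar P_{\mathrm{Bob}})-2}}{8}.$$
   Context: Let $\mathcal H$ be a complex Hilbert space with $\dim\mathcal H=2$ and $\mathcal L(\mathcal H)$ the linear operators on it. A two-outcome POVM is an ordered pair $(B_0,B_1)$ of positive semidefinite operators in $\mathcal L(\mathcal H)$ with $B_0+B_1=\mathbb 1$. A two-outcome (qubit) instrument is an ordered pair $(\mathcal B_0,\mathcal B_1)$ of completely positive trace-nonincreasing maps $\mathcal L(\mathcal H)\to\mathcal L(\mathcal H)$ whose sum $\mathcal B_0+\mathcal B_1$ is trace preserving. The game: Alice receives $\vec x=(x_0,x_1)\in\{0,1\}^2$, Bob receives $y\in\{0,1\}$, Charlie receives $z\in\{0,1\}$; all bits are independent and uniformly distributed. Without shared randomness, a strategy consists of qubit density operators $\varrho_{\vec x}$ for $\vec x\in\{0,1\}^2$ (prepared by Alice and sent to Bob), instruments $(\mathcal B^y_0,\mathcal B^y_1)$ for $y=0,1$ (applied by Bob, who outputs $b$ and sends the resulting qubit to Charlie), and two-outcome POVMs $(C^z_0,C^z_1)$ for $z=0,1$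 (measured by Charlie, who outputs $c$), giving $$p(b,c|\vec x,y,z)=\mathrm{tr}\big(\mathcal B^y_b(\varrho_{\vec x})\,C^z_c\big).$$ The parties share no entanglement but may share arbitrary classical randomness: a general strategy chooses such a tuple of states, instruments and POVMs according to a shared random variable independent of the inputs, and $p(b,c|\vec x,y,z)$ is the corresponding average. Put $\Pr(b|\vec x,y)=\sum_c p(b,c|\vec x,y,z)$ (independent of $z$) and $\Pr(c|\vec x,z)=\frac12\sum_{y}\sum_b p(b,c|\vec x,y,z)$. The guessing probabilities are $$\bar P_{\mathrm{Bob}}=\frac18\sum_{\vec x,y}\Pr(b=x_y|\vec x,y),\qquad \bar P_{\mathrm{Charlie}}=\frac18\sum_{\vec x,z}\Pr(c=x_z|\vec x,z).$$ *)

theory Defs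
  imports "HOL-Probability.Probability"
begin

text \<open>The two-dimensional complex Hilbert space is \<open>complex^2\<close>; operators on it are
  their matrices in the standard orthonormal basis. Bits are Booleans, with \<open>False\<close> for
  0 and \<open>True\<close> for 1.\<close>

type_synonym qubit_op = "complex^2^2"

subsection \<open>States, measurements and instruments\<close>

definition sesq :: "complex^2 \<Rightarrow> qubit_op \<Rightarrow> complex^2 \<Rightarrow> complex" where
  "sesq u A v = (\<Sum>i\<in>UNIV. cnj (u $ i) * (A *v v) $ i)"

definition psd :: "qubit_op \<Rightarrow> bool" where
  "psd A \<longleftrightarrow> (\<forall>v. sesq v A v \<in> \<real>\<^sub>\<ge>\<^sub>0)"

definition density_operator :: "qubit_op \<Rightarrow> bool" where
  "density_operator R \<longleftrightarrow> psd R \<and> trace R = 1"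

definition povm :: "(bool \<Rightarrow> qubit_op) \<Rightarrow> bool" where
  "povm C \<longleftrightarrow> (\<forall>c. psd (C c)) \<and> C False + C True = mat 1"

definition complex_linear :: "(qubit_op \<Rightarrow> qubit_op) \<Rightarrow> bool" where
  "complex_linear F \<longleftrightarrow> (\<forall>X Y. F (X + Y) = F X + F Y) \<and>
     (\<forall>c X. F (map_matrix ((*) c) X) = map_matrix ((*) c) (F X))"

text \<open>An operator on the tensor product of \<open>n\<close>-dimensional space with the qubit space is
  given as an \<open>n\<close> by \<open>n\<close> block matrix \<open>X\<close> of qubit operators, and a vector as \<open>n\<close> qubit
  vectors; the identity on the first factor tensored with \<open>F\<close> applies \<open>F\<close> to each block.\<close>

definition block_psd :: "nat \<Rightarrow> (nat \<Rightarrow> nat \<Rightarrow> qubit_op) \<Rightarrow> bool" where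
  "block_psd n X \<longleftrightarrow>
     (\<forall>v. (\<Sum>k<n. \<Sum>l<n. sesq (v k) (X k l) (v l)) \<in> \<real>\<^sub>\<ge>\<^sub>0)"

definition completely_positive :: "(qubit_op \<Rightarrow> qubit_op) \<Rightarrow> bool" where
  "completely_positive F \<longleftrightarrow> complex_linear F \<and>
     (\<forall>n X. block_psd n X \<longrightarrow> block_psd n (\<lambda>k l. F (X k l)))"

definition trace_nonincreasing :: "(qubit_op \<Rightarrow> qubit_op) \<Rightarrow> bool" where
  "trace_nonincreasing F \<longleftrightarrow> (\<forall>X. psd X \<longrightarrow> Re (trace (F X)) \<le> Re (trace X))"

definition trace_preserving :: "(qubit_op \<Rightarrow> qubit_op) \<Rightarrow> bool" where
  "trace_preserving F \<longleftrightarrow> (\<forall>X. trace (F X) = trace X)"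

definition instrument :: "(bool \<Rightarrow> qubit_op \<Rightarrow> qubit_op) \<Rightarrow> bool" where
  "instrument B \<longleftrightarrow> (\<forall>b. completely_positive (B b) \<and> trace_nonincreasing (B b)) \<and>
     trace_preserving (\<lambda>X. B False X + B True X)"

subsection \<open>Strategies\<close>

record strategy =
  alice :: "bool \<times> bool \<Rightarrow> qubit_op"
  bob :: "bool \<Rightarrow> bool \<Rightarrow> qubit_op \<Rightarrow> qubit_op"
  charlie :: "bool \<Rightarrow> bool \<Rightarrow> qubit_op"

text \<open>The arguments of \<open>bob S y b\<close> and \<open>charlie S z c\<close> are the input and then the outcome.\<close>

definition valid_strategy :: "strategy \<Rightarrow> bool" where
  "valid_strategy S \<longleftrightarrow> (\<forall>x. density_operator (alice S x)) \<and>
     (\<forall>y. instrument (bob S y)) \<and> (\<forall>z. povm (charlie S z))"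

text \<open>Shared randomness is a point of an arbitrary probability space \<open>M\<close>, and \<open>S\<close> is a
  strategy-valued random variable on it.\<close>

definition shared_strategy :: "'r measure \<Rightarrow> ('r \<Rightarrow> strategy) \<Rightarrow> bool" where
  "shared_strategy M S \<longleftrightarrow> prob_space M \<and>
     (\<forall>r\<in>space M. valid_strategy (S r)) \<and>
     (\<forall>x. (\<lambda>r. alice (S r) x) \<in> borel_measurable M) \<and>
     (\<forall>y b X. (\<lambda>r. bob (S r) y b X) \<in> borel_measurable M) \<and>
     (\<forall>z c. (\<lambda>r. charlie (S r) z c) \<in> borel_measurable M)"

subsection \<open>Correlations and guessing probabilities\<close>

text \<open>The trace below is real for valid strategies.\<close>

definition behaviour :: "strategy \<Rightarrow> bool \<Rightarrow> bool \<Rightarrow> bool \<times> bool \<Rightarrow> bool \<Rightarrow> bool \<Rightarrow> real" where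
  "behaviour S b c x y z = Re (trace (bob S y b (alice S x) ** charlie S z c))"

definition prob_bc ::
  "'r measure \<Rightarrow> ('r \<Rightarrow> strategy) \<Rightarrow> bool \<Rightarrow> bool \<Rightarrow> bool \<times> bool \<Rightarrow> bool \<Rightarrow> bool \<Rightarrow> real" where
  "prob_bc M S b c x y z = (\<integral>r. behaviour (S r) b c x y z \<partial>M)"

text \<open>Bob's marginal does not depend on \<open>z\<close> (lemma \<open>prob_b_eq\<close> below), so \<open>z\<close> is set to 0.\<close>

definition prob_b :: "'r measure \<Rightarrow> ('r \<Rightarrow> strategy) \<Rightarrow> bool \<Rightarrow> bool \<times> bool \<Rightarrow> bool \<Rightarrow> real" where
  "prob_b M S b x y = (\<Sum>c\<in>UNIV. prob_bc M S b c x y False)"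

definition prob_c :: "'r measure \<Rightarrow> ('r \<Rightarrow> strategy) \<Rightarrow> bool \<Rightarrow> bool \<times> bool \<Rightarrow> bool \<Rightarrow> real" where
  "prob_c M S c x z = 1/2 * (\<Sum>y\<in>UNIV. \<Sum>b\<in>UNIV. prob_bc M S b c x y z)"

definition sel :: "bool \<times> bool \<Rightarrow> bool \<Rightarrow> bool" where
  "sel x y = (if y then snd x else fst x)"

definition P_Bob :: "'r measure \<Rightarrow> ('r \<Rightarrow> strategy) \<Rightarrow> real" where
  "P_Bob M S = 1/8 * (\<Sum>x\<in>UNIV. \<Sum>y\<in>UNIV. prob_b M S (sel x y) x y)"

definition P_Charlie :: "'r measure \<Rightarrow> ('r \<Rightarrow> strategy) \<Rightarrow> real" where
  "P_Charlie M S = 1/8 * (\<Sum>x\<in>UNIV. \<Sum>z\<in>UNIV. prob_c M S (sel x z) x z)"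

subsection \<open>Bob's marginal is independent of Charlie's input\<close>

lemma sesq_2:
  "sesq u A v = cnj (u$1) * (A$1$1 * v$1 + A$1$2 * v$2) + cnj (u$2) * (A$2$1 * v$1 + A$2$2 * v$2)"
  by (simp add: sesq_def matrix_vector_mult_def sum_2)

lemma psd_entries:
  assumes "psd A"
  shows "A$i$i \<in> \<real>\<^sub>\<ge>\<^sub>0" and "norm (A$i$j) \<le> Re (trace A)"
proof -
  have q: "cnj a * (A$1$1 * a + A$1$2 * b) + cnj b * (A$2$1 * a + A$2$2 * b) \<in> \<real>\<^sub>\<ge>\<^sub>0" for a b
    using assms[unfolded psd_def sesq_2, rule_format, of "vector [a, b]"] by simp
  have d1: "A$1$1 \<in> \<real>\<^sub>\<ge>\<^sub>0" using q[of 1 0] by simp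
  have d2: "A$2$2 \<in> \<real>\<^sub>\<ge>\<^sub>0" using q[of 0 1] by simp
  have e1: "Im (A$1$2) + Im (A$2$1) = 0"
    using q[of 1 1] d1 d2 by (simp add: complex_nonneg_Reals_iff)
  have e2: "Re (A$1$2) = Re (A$2$1)"
    using q[of 1 \<i>] d1 d2 by (simp add: complex_nonneg_Reals_iff)
  have h: "A$2$1 = cnj (A$1$2)" using e1 e2 by (simp add: complex_eq_iff)
  have tr: "Re (trace A) = Re (A$1$1) + Re (A$2$2)" by (simp add: trace_def sum_2)
  have off: "2 * norm (A$1$2) \<le> Re (A$1$1) + Re (A$2$2)"
  proof (cases "A$1$2 = 0")
    case True
    then show ?thesis using d1 d2 by (simp add: complex_nonneg_Reals_iff)
  next
    case False
    define t where "t = A$1$2"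
    have t0: "t \<noteq> 0" using False t_def by simp
    define w where "w = - cnj t / of_real (norm t)"
    have tw: "t * w = - of_real (norm t)"
      using t0 by (simp add: w_def complex_norm_square[symmetric] power2_eq_square)
    have ww: "cnj w * w = 1"
    proof -
      have "norm w = 1" using t0 by (simp add: w_def norm_divide)
      then show ?thesis using complex_norm_square[of w] by (simp add: mult.commute)
    qed
    have tw': "cnj w * cnj t = - of_real (norm t)"
      using arg_cong[OF tw, of cnj] by (simp add: mult.commute)
    have "cnj 1 * (A$1$1 * 1 + A$1$2 * w) + cnj w * (A$2$1 * 1 + A$2$2 * w)
        = A$1$1 + t * w + cnj w * cnj t + A$2$2 * (cnj w * w)"
      by (simp add: h t_def algebra_simps)
    also have "\<dots> = A$1$1 + A$2$2 - 2 * of_real (norm t)"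
      by (simp add: tw tw' ww)
    finally have "A$1$1 + A$2$2 - 2 * of_real (norm t) \<in> \<real>\<^sub>\<ge>\<^sub>0"
      using q[of 1 w] by (simp only:)
    then show ?thesis by (simp add: complex_nonneg_Reals_iff t_def)
  qed
  have n1: "norm (A$1$1) = Re (A$1$1)" and n2: "norm (A$2$2) = Re (A$2$2)"
    using d1 d2 by (auto simp: complex_nonneg_Reals_iff cmod_eq_Re)
  have all_2: "i = 1 \<or> i = 2" for i :: 2 by (rule exhaust_2)
  show "A$i$i \<in> \<real>\<^sub>\<ge>\<^sub>0" using all_2[of i] d1 d2 by auto
  have "0 \<le> norm (A$1$2)" "norm (A$2$1) = norm (A$1$2)" by (simp_all add: h)
  moreover have "0 \<le> Re (A$1$1)" "0 \<le> Re (A$2$2)"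
    using d1 d2 by (auto simp: complex_nonneg_Reals_iff)
  ultimately show "norm (A$i$j) \<le> Re (trace A)"
    using all_2[of i] all_2[of j] off n1 n2 tr by auto
qed

lemma completely_positive_psd:
  assumes "completely_positive F" "psd X"
  shows "psd (F X)"
proof -
  have "block_psd 1 (\<lambda>_ _. X)" using assms(2) by (simp add: block_psd_def psd_def)
  then have b: "block_psd 1 (\<lambda>_ _. F X)" using assms(1) unfolding completely_positive_def by blast
  show ?thesis unfolding psd_def
  proof
    fix v
    show "sesq v (F X) v \<in> \<real>\<^sub>\<ge>\<^sub>0"
      using b[unfolded block_psd_def, rule_format, of "\<lambda>_. v"] by simp
  qed
qed

lemma trace_matrix_mult_2:
  fixes A C :: qubit_op
  shows "trace (A ** C) = A$1$1 * C$1$1 + A$1$2 * C$2$1 + A$2$1 * C$1$2 + A$2$2 * C$2$2"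
  by (simp add: trace_def matrix_matrix_mult_def sum_2)

lemma complex_linear_expand:
  assumes "complex_linear F"
  shows "F X $ i $ j = (\<Sum>k\<in>UNIV. \<Sum>l\<in>UNIV.
    X$k$l * F (\<chi> m n. if m = k \<and> n = l then 1 else 0) $ i $ j)"
proof -
  define E :: "2 \<Rightarrow> 2 \<Rightarrow> qubit_op" where
    "E k l = (\<chi> m n. if m = k \<and> n = l then 1 else 0)" for k l
  have X: "X = map_matrix ((*) (X$1$1)) (E 1 1) + map_matrix ((*) (X$1$2)) (E 1 2)
      + map_matrix ((*) (X$2$1)) (E 2 1) + map_matrix ((*) (X$2$2)) (E 2 2)"
    by (simp add: vec_eq_iff forall_2 E_def map_matrix_def)
  have "F X = map_matrix ((*) (X$1$1)) (F (E 1 1)) + map_matrix ((*) (X$1$2)) (F (E 1 2))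
      + map_matrix ((*) (X$2$1)) (F (E 2 1)) + map_matrix ((*) (X$2$2)) (F (E 2 2))"
    using assms unfolding complex_linear_def by (subst X) (simp only:)
  then have "F X $ i $ j = (\<Sum>k\<in>UNIV. \<Sum>l\<in>UNIV. X$k$l * F (E k l) $ i $ j)"
    by (simp add: sum_2 map_matrix_def)
  then show ?thesis by (simp only: E_def)
qed

lemma behaviour_bound:
  assumes "valid_strategy S"
  shows "\<bar>behaviour S b c x y z\<bar> \<le> 8"
proof -
  define A where "A = bob S y b (alice S x)"
  define C where "C = charlie S z c"
  have dens: "density_operator (alice S x)" and ins: "instrument (bob S y)"
    and pv: "povm (charlie S z)"
    using assms by (simp_all add: valid_strategy_def del: split_paired_All)
  have pA: "psd A" using dens ins completely_positive_psd
    by (auto simp: A_def instrument_def density_operator_def)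
  have "Re (trace A) \<le> 1" using dens ins
    by (force simp: A_def instrument_def density_operator_def trace_nonincreasing_def)
  then have nA: "norm (A$i$j) \<le> 1" for i j using psd_entries(2)[OF pA, of i j] by linarith
  have pC: "psd C" "psd (charlie S z (\<not> c))" using pv by (auto simp: C_def povm_def)
  have "C + charlie S z (\<not> c) = mat 1"
    using pv by (cases c) (auto simp: C_def povm_def add.commute)
  then have "trace C + trace (charlie S z (\<not> c)) = trace (mat 1 :: qubit_op)"
    by (metis trace_add)
  also have "\<dots> = 2" by (simp add: trace_def mat_def sum_2)
  finally have "Re (trace C) + Re (trace (charlie S z (\<not> c))) = 2"
    using plus_complex.sel(1)[of "trace C" "trace (charlie S z (\<not> c))"] by simp
  moreover have "0 \<le> Re (trace (charlie S z (\<not> c)))"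
    using psd_entries(2)[OF pC(2), of 1 1] norm_ge_zero order_trans by blast
  ultimately have "Re (trace C) \<le> 2" by linarith
  then have nC: "norm (C$i$j) \<le> 2" for i j using psd_entries(2)[OF pC(1), of i j] by linarith
  have nAC: "norm (A$i$j * C$k$l) \<le> 2" for i j k l
    using mult_mono[OF nA[of i j] nC[of k l]] by (simp add: norm_mult)
  have "norm (trace (A ** C)) \<le> norm (A$1$1 * C$1$1) + norm (A$1$2 * C$2$1)
      + norm (A$2$1 * C$1$2) + norm (A$2$2 * C$2$2)"
    unfolding trace_matrix_mult_2
    by (intro norm_triangle_le add_right_mono norm_triangle_ineq) simp
  also have "\<dots> \<le> 8" using nAC[of 1 1 1 1] nAC[of 1 2 2 1] nAC[of 2 1 1 2] nAC[of 2 2 2 2]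
    by linarith
  finally show ?thesis
    unfolding behaviour_def A_def[symmetric] C_def[symmetric]
    using abs_Re_le_cmod order_trans by blast
qed

lemma borel_measurable_entry:
  fixes f :: "'r \<Rightarrow> qubit_op"
  assumes "f \<in> borel_measurable M"
  shows "(\<lambda>r. f r $ i $ j) \<in> borel_measurable M"
  by (rule borel_measurable_continuous_on[OF _ assms, of "\<lambda>A. A $ i $ j"])
    (intro continuous_intros)

lemma integrable_behaviour:
  assumes "shared_strategy M S"
  shows "integrable M (\<lambda>r. behaviour (S r) b c x y z)"
proof -
  interpret prob_space M using assms by (simp add: shared_strategy_def)
  have v: "valid_strategy (S r)" if "r \<in> space M" for r
    using assms that by (simp add: shared_strategy_def)
  have lin: "complex_linear (bob (S r) y b)" if "r \<in> space M" for r
    using v[OF that] by (auto simp: valid_strategy_def instrument_def completely_positive_def)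
  have a: "(\<lambda>r. alice (S r) x $ i $ j) \<in> borel_measurable M" for i j
    using assms unfolding shared_strategy_def by (intro borel_measurable_entry) blast
  have c [measurable]: "(\<lambda>r. charlie (S r) z c $ i $ j) \<in> borel_measurable M" for i j
    using assms unfolding shared_strategy_def by (intro borel_measurable_entry) blast
  have bX: "(\<lambda>r. bob (S r) y b X $ i $ j) \<in> borel_measurable M" for X i j
    using assms unfolding shared_strategy_def by (intro borel_measurable_entry) blast
  have ba [measurable]: "(\<lambda>r. bob (S r) y b (alice (S r) x) $ i $ j) \<in> borel_measurable M" for i j
  proof -
    have "(\<lambda>r. \<Sum>k\<in>UNIV. \<Sum>l\<in>UNIV. alice (S r) x $ k $ l *
        bob (S r) y b (\<chi> m n. if m = k \<and> n = l then 1 else 0) $ i $ j) \<in> borel_measurable M"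
      by (intro borel_measurable_sum borel_measurable_times a bX)
    then show ?thesis
      by (subst measurable_cong[OF complex_linear_expand[OF lin]])
  qed
  have "(\<lambda>r. behaviour (S r) b c x y z) \<in> borel_measurable M"
    unfolding behaviour_def trace_matrix_mult_2 by measurable
  then show ?thesis
    by (rule integrable_const_bound[where B = 8, rotated])
      (auto intro!: AE_I2 behaviour_bound v)
qed

lemma prob_b_eq:
  assumes "shared_strategy M S"
  shows "prob_b M S b x y = (\<Sum>c\<in>UNIV. prob_bc M S b c x y z)"
proof -
  have *: "(\<Sum>c\<in>UNIV. prob_bc M S b c x y z) =
      (\<integral>r. Re (trace (bob (S r) y b (alice (S r) x))) \<partial>M)" for z
  proof -
    have "(\<Sum>c\<in>UNIV. prob_bc M S b c x y z) =
        (\<integral>r. (\<Sum>c\<in>UNIV. behaviour (S r) b c x y z) \<partial>M)"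
      unfolding prob_bc_def
      by (rule Bochner_Integration.integral_sum[symmetric]) (rule integrable_behaviour[OF assms])
    also have "\<dots> = (\<integral>r. Re (trace (bob (S r) y b (alice (S r) x))) \<partial>M)"
    proof (rule Bochner_Integration.integral_cong[OF refl])
      fix r assume "r \<in> space M"
      then have "charlie (S r) z False + charlie (S r) z True = mat 1"
        using assms by (auto simp: shared_strategy_def valid_strategy_def povm_def)
      moreover have "(\<Sum>c\<in>UNIV. behaviour (S r) b c x y z) =
          Re (trace (bob (S r) y b (alice (S r) x) **
            (charlie (S r) z False + charlie (S r) z True)))"
        by (simp add: behaviour_def UNIV_bool matrix_add_ldistrib trace_add)
      ultimately show "(\<Sum>c\<in>UNIV. behaviour (S r) b c x y z) =
          Re (trace (bob (S r) y b (alice (S r) x)))"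
        by simp
    qed
    finally show ?thesis .
  qed
  show ?thesis unfolding prob_b_def by (simp only: *)
qed

end

theory Submission
  imports Defs
begin

text \<open>In terms of \<open>u = 4 P_Bob - 2\<close> and \<open>v = 8 P_Charlie - 4 - sqrt 2\<close> the bound cuts out a convex
  region, described by \<open>s u + t v \<le> sqrt 2\<close> for \<open>s\<^sup>2 + t\<^sup>2 = 1\<close> and \<open>t \<ge> 0\<close>. These inequalities
  are linear, so they need only be proved without shared randomness.

  For fixed \<open>y\<close> and \<open>z\<close>, the outcomes of Bob and Charlie jointly measure two observables on
  Alice's qubit; their Bloch vectors \<open>m\<close> and \<open>n\<close> satisfy \<open>|m + n| + |m - n| \<le> 2\<close>. The states
  enter only through two vectors \<open>p = d + g\<close> and \<open>q = d - g\<close>, where \<open>d\<close> and \<open>g\<close> are half the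
  differences of the Bloch vectors of complementary inputs. Bob's observable for one bit is
  played against Charlie's for the other one, while Charlie's observable for the bit that
  Bob guesses is bounded trivially.\<close>

section \<open>Positive semidefinite qubit operators\<close>

text \<open>A Hermitian 2 by 2 matrix with nonnegative diagonal is positive exactly if its
  determinant is nonnegative. The off-diagonal term of the quadratic form is absorbed into the
  diagonal ones by AM-GM.\<close>

lemma psd_iff:
  "psd A \<longleftrightarrow> A$1$1 \<in> \<real>\<^sub>\<ge>\<^sub>0 \<and> A$2$2 \<in> \<real>\<^sub>\<ge>\<^sub>0 \<and> A$2$1 = cnj (A$1$2) \<and>
     (cmod (A$1$2))\<^sup>2 \<le> Re (A$1$1) * Re (A$2$2)" (is "_ \<longleftrightarrow> ?R")
proof
  assume "psd A"
  have q: "cnj a * (A$1$1 * a + A$1$2 * b) + cnj b * (A$2$1 * a + A$2$2 * b) \<in> \<real>\<^sub>\<ge>\<^sub>0" for a b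
    using \<open>psd A\<close>[unfolded psd_def sesq_2, rule_format, of "vector [a, b]"] by simp
  have d: "A$1$1 \<in> \<real>\<^sub>\<ge>\<^sub>0" "A$2$2 \<in> \<real>\<^sub>\<ge>\<^sub>0"
    using \<open>psd A\<close> by (rule psd_entries(1))+
  obtain x y where xy: "A$1$1 = of_real x" "A$2$2 = of_real y" "x \<ge> 0" "y \<ge> 0"
    using d by (auto elim!: nonneg_Reals_cases)
  have "Im (A$1$2) + Im (A$2$1) = 0" "Re (A$1$2) = Re (A$2$1)"
    using q[of 1 1] q[of 1 \<i>] d by (simp_all add: complex_nonneg_Reals_iff)
  then have h: "A$2$1 = cnj (A$1$2)" by (simp add: complex_eq_iff)
  have "(cmod (A$1$2))\<^sup>2 \<le> x * y"
  proof (cases "x + y = 0")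
    case True
    then show ?thesis
      using psd_entries(2)[OF \<open>psd A\<close>, of 1 2] xy by (simp add: trace_def sum_2)
  next
    case False
    \<comment> \<open>Each of the two test vectors is annihilated by one row of \<open>A\<close>, so
      the form evaluates to a diagonal entry times the determinant. Adding both results requires
      only one nonzero diagonal entry.\<close>
    have "x * (x * y - (cmod (A$1$2))\<^sup>2) \<ge> 0"
      using q[of "A$1$2" "- of_real x"] unfolding cmod_power2
      by (simp add: h xy complex_nonneg_Reals_iff power2_eq_square algebra_simps)
    moreover have "y * (x * y - (cmod (A$1$2))\<^sup>2) \<ge> 0"
      using q[of "- of_real y" "A$2$1"] unfolding cmod_power2
      by (simp add: h xy complex_nonneg_Reals_iff power2_eq_square algebra_simps)
    ultimately have "(x + y) * (x * y - (cmod (A$1$2))\<^sup>2) \<ge> 0"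
      by (simp add: distrib_right)
    then show ?thesis using False xy by (simp add: zero_le_mult_iff)
  qed
  then show ?R using d h xy by simp
next
  assume R: ?R
  obtain x y where xy: "A$1$1 = of_real x" "A$2$2 = of_real y" "x \<ge> 0" "y \<ge> 0"
    using R by (auto elim!: nonneg_Reals_cases)
  define t where "t = A$1$2"
  have h: "A$2$1 = cnj t" and t: "(cmod t)\<^sup>2 \<le> x * y" using R xy by (simp_all add: t_def)
  have "sesq v A v \<in> \<real>\<^sub>\<ge>\<^sub>0" for v
  proof -
    define a b where "a = v$1" and "b = v$2"
    have "sesq v A v = of_real (x * (cmod a)\<^sup>2 + y * (cmod b)\<^sup>2) + (cnj a * t * b + cnj (cnj a * t * b))"
      unfolding sesq_2 by (simp add: h xy t_def[symmetric] a_def[symmetric] b_def[symmetric]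
        complex_norm_square[unfolded of_real_power] algebra_simps)
    also have "\<dots> = of_real (x * (cmod a)\<^sup>2 + y * (cmod b)\<^sup>2 + 2 * Re (cnj a * t * b))"
      unfolding complex_add_cnj by simp
    finally have eq: "sesq v A v = \<dots>" .
    have "cmod t \<le> sqrt x * sqrt y"
      using real_le_rsqrt[OF t] by (simp add: real_sqrt_mult)
    then have "cmod t * (cmod a * cmod b) \<le> (sqrt x * sqrt y) * (cmod a * cmod b)"
      by (rule mult_right_mono) simp
    moreover have "\<bar>Re (cnj a * t * b)\<bar> \<le> cmod t * (cmod a * cmod b)"
      using abs_Re_le_cmod[of "cnj a * t * b"] by (simp add: norm_mult mult_ac)
    moreover have "0 \<le> (sqrt x * cmod a - sqrt y * cmod b)\<^sup>2" by simp
    ultimately have "0 \<le> x * (cmod a)\<^sup>2 + y * (cmod b)\<^sup>2 + 2 * Re (cnj a * t * b)"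
      using xy(3,4) by (simp add: power2_diff power_mult_distrib algebra_simps)
    then show ?thesis by (simp add: eq complex_nonneg_Reals_iff)
  qed
  then show "psd A" by (simp add: psd_def)
qed

text \<open>The off-diagonal entries contribute at least
  \<open>-2 * cmod (A$1$2) * cmod (C$1$2)\<close>. The two determinant conditions and AM-GM bound
  this loss by the diagonal contribution.\<close>

lemma trace_mult_psd_nonneg:
  assumes "psd A" "psd C"
  shows "0 \<le> Re (trace (A ** C))"
proof -
  obtain x y where A: "A$1$1 = of_real x" "A$2$2 = of_real y" "x \<ge> 0" "y \<ge> 0"
      "A$2$1 = cnj (A$1$2)" "(cmod (A$1$2))\<^sup>2 \<le> x * y"
    using assms(1) unfolding psd_iff by (auto elim!: nonneg_Reals_cases)
  obtain x' y' where C: "C$1$1 = of_real x'" "C$2$2 = of_real y'" "x' \<ge> 0" "y' \<ge> 0"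
      "C$2$1 = cnj (C$1$2)" "(cmod (C$1$2))\<^sup>2 \<le> x' * y'"
    using assms(2) unfolding psd_iff by (auto elim!: nonneg_Reals_cases)
  have "cmod (A$1$2) \<le> sqrt (x * y)" "cmod (C$1$2) \<le> sqrt (x' * y')"
    using A(6) C(6) by (auto intro: real_le_rsqrt)
  then have "cmod (A$1$2) * cmod (C$1$2) \<le> sqrt (x * y) * sqrt (x' * y')"
    using A C by (intro mult_mono) auto
  then have "cmod (A$1$2) * cmod (C$1$2) \<le> sqrt (x * x') * sqrt (y * y')"
    by (simp add: real_sqrt_mult mult_ac)
  moreover have "0 \<le> (sqrt (x * x') - sqrt (y * y'))\<^sup>2" by simp
  then have "2 * (sqrt (x * x') * sqrt (y * y')) \<le> x * x' + y * y'"
    using A C by (simp add: power2_diff)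
  moreover have "\<bar>Re (A$1$2 * cnj (C$1$2))\<bar> \<le> cmod (A$1$2) * cmod (C$1$2)"
    using abs_Re_le_cmod[of "A$1$2 * cnj (C$1$2)"] by (simp add: norm_mult)
  moreover have "Re (trace (A ** C)) = x * x' + y * y' + 2 * Re (A$1$2 * cnj (C$1$2))"
    unfolding trace_matrix_mult_2 by (simp add: A C)
  ultimately show ?thesis by linarith
qed

section \<open>Bloch vectors of qubit states\<close>

text \<open>A Bloch vector is stored as \<open>(z, w)\<close>, where \<open>z / 2\<close> is the off-diagonal entry of the
  state, so that \<open>z\<close> combines the coordinates along the Pauli X and Y axes.\<close>

definition bloch :: "complex \<times> real \<Rightarrow> qubit_op" where
  "bloch r = (1/2) *\<^sub>R vector [vector [of_real (snd r), fst r], vector [cnj (fst r), - of_real (snd r)]]"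

definition bloch_state :: "complex \<times> real \<Rightarrow> qubit_op" where
  "bloch_state r = (1/2) *\<^sub>R mat 1 + bloch r"

lemma linear_bloch: "linear bloch"
  by (rule linearI) (auto simp: bloch_def vec_eq_iff forall_2 algebra_simps scaleR_conv_of_real[where 'a=complex])

lemma bloch_state_entries:
  "bloch_state r $ 1 $ 1 = of_real ((1 + snd r) / 2)" "bloch_state r $ 2 $ 2 = of_real ((1 - snd r) / 2)"
  "bloch_state r $ 1 $ 2 = fst r / 2" "bloch_state r $ 2 $ 1 = cnj (fst r) / 2"
  by (simp_all add: bloch_state_def bloch_def mat_def scaleR_conv_of_real[where 'a=complex] add_divide_distrib diff_divide_distrib)

text \<open>The right-hand side is the determinant condition of \<open>psd_iff\<close> for
  \<open>bloch_state r\<close>, so this identifies qubit states with the unit ball.\<close>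

lemma norm_le_1_bloch_iff:
  "norm r \<le> 1 \<longleftrightarrow> (cmod (fst r / 2))\<^sup>2 \<le> ((1 + snd r) / 2) * ((1 - snd r) / 2)"
  by (simp add: norm_prod_def norm_divide power_divide field_simps power2_eq_square)

lemma psd_bloch_state:
  assumes "norm r \<le> 1"
  shows "psd (bloch_state r)"
proof -
  have "\<bar>snd r\<bar> \<le> 1" using norm_snd_le[of "snd r" "fst r"] assms by simp
  then show ?thesis
    using assms unfolding psd_iff bloch_state_entries norm_le_1_bloch_iff
    by (auto simp: complex_nonneg_Reals_iff abs_le_iff)
qed

lemma trace_bloch_state: "trace (bloch_state r) = 1"
  unfolding trace_def sum_2 bloch_state_entries
  by (simp add: add_divide_distrib diff_divide_distrib)

lemma density_operator_bloch:
  assumes "density_operator R"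
  obtains r where "norm r \<le> 1" "R = bloch_state r"
proof -
  have R: "psd R" "trace R = 1" using assms by (simp_all add: density_operator_def)
  obtain x y where A: "R$1$1 = of_real x" "R$2$2 = of_real y"
      "R$2$1 = cnj (R$1$2)" "(cmod (R$1$2))\<^sup>2 \<le> x * y"
    using R(1) unfolding psd_iff by (auto elim!: nonneg_Reals_cases)
  have "complex_of_real (x + y) = 1" using R(2) by (simp add: trace_def sum_2 A)
  then have y: "y = 1 - x" by (metis add_diff_cancel_left' of_real_eq_1_iff)
  define r where "r = (2 * R$1$2, 2 * x - 1)"
  have "norm r \<le> 1"
    unfolding norm_le_1_bloch_iff using A(4) y by (simp add: r_def diff_divide_distrib)
  moreover have "R = bloch_state r"
    unfolding vec_eq_iff forall_2 bloch_state_entries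
    by (simp add: r_def A y)
  ultimately show thesis by (rule that)
qed

section \<open>Outcome probabilities as affine functions of the Bloch vector\<close>

lemma linear_functional_inner:
  fixes g :: "'a::euclidean_space \<Rightarrow> real"
  assumes "linear g"
  obtains v where "\<And>x. g x = v \<bullet> x"
proof
  show "g x = (\<Sum>b\<in>Basis. g b *\<^sub>R b) \<bullet> x" for x
  proof -
    have "g x = g (\<Sum>b\<in>Basis. (x \<bullet> b) *\<^sub>R b)" by (simp add: euclidean_representation)
    also have "\<dots> = (\<Sum>b\<in>Basis. (x \<bullet> b) * g b)"
      by (simp add: linear_sum[OF assms] linear_cmul[OF assms])
    finally show ?thesis by (simp add: inner_sum_left inner_commute[of x] mult.commute)
  qed
qed

text \<open>On the unit ball the affine function is smallest at the unit vector opposite to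
  \<open>v\<close>.\<close>

lemma norm_le_if_affine_nonneg:
  fixes v :: "'a::real_inner"
  assumes "\<And>r. norm r \<le> 1 \<Longrightarrow> 0 \<le> \<mu> + v \<bullet> r"
  shows "norm v \<le> \<mu>"
proof (cases "v = 0")
  case True
  then show ?thesis using assms[of 0] by simp
next
  case False
  have "0 \<le> \<mu> + v \<bullet> (- (v /\<^sub>R norm v))" using False by (intro assms) simp
  also have "\<dots> = \<mu> - norm v"
    using False by (simp add: dot_square_norm power2_eq_square)
  finally show ?thesis by simp
qed

lemma complex_linear_imp_linear:
  assumes "complex_linear F"
  shows "linear F"
proof (rule linearI)
  have *: "map_matrix ((*) (of_real c)) X = c *\<^sub>R X" for c and X :: qubit_op
    by (simp add: vec_eq_iff map_matrix_def scaleR_conv_of_real[where 'a=complex])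
  show "F (c *\<^sub>R X) = c *\<^sub>R F X" for c X
    using assms unfolding complex_linear_def *[symmetric] by blast
qed (use assms in \<open>simp add: complex_linear_def\<close>)

text \<open>In the Heisenberg picture the outcome pair \<open>(b, c)\<close> is an effect on Alice's
  qubit. Here \<mu> is its value at the maximally mixed state, and nonnegativity on all states
  forces \<open>norm v\<close> to be at most \<mu>.\<close>

lemma behaviour_bloch:
  assumes S: "valid_strategy S"
  obtains \<mu> :: real and v :: "complex \<times> real"
  where "norm v \<le> \<mu>" "\<And>r. Re (trace (bob S y b (bloch_state r) ** charlie S z c)) = \<mu> + v \<bullet> r"
proof -
  define W where "W X = Re (trace (bob S y b X ** charlie S z c))" for X
  have cp: "completely_positive (bob S y b)" and pc: "psd (charlie S z c)"
    using S by (simp_all add: valid_strategy_def instrument_def povm_def)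
  have lin: "linear (bob S y b)"
    using cp by (intro complex_linear_imp_linear) (simp add: completely_positive_def)
  have linW: "linear W"
    by (rule linearI) (simp_all add: W_def trace_matrix_mult_2 linear_add[OF lin]
        linear_cmul[OF lin] algebra_simps)
  obtain v where v: "\<And>r. (W \<circ> bloch) r = v \<bullet> r"
    using linear_functional_inner[OF linear_compose[OF linear_bloch linW]] by blast
  have eq: "W (bloch_state r) = W ((1/2) *\<^sub>R mat 1) + v \<bullet> r" for r
    using v[of r] by (simp add: bloch_state_def linear_add[OF linW])
  have "norm v \<le> W ((1/2) *\<^sub>R mat 1)"
  proof (rule norm_le_if_affine_nonneg)
    fix r :: "complex \<times> real" assume "norm r \<le> 1"
    then show "0 \<le> W ((1/2) *\<^sub>R mat 1) + v \<bullet> r"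
      unfolding eq[symmetric] unfolding W_def
      by (rule trace_mult_psd_nonneg[OF completely_positive_psd[OF cp psd_bloch_state] pc])
  qed
  then show thesis using that eq unfolding W_def by blast
qed

definition bit_sign :: "bool \<Rightarrow> real" where
  "bit_sign b = (if b then -1 else 1)"

text \<open>The four effects add up to the identity. Hence \<open>m + n\<close> and
  \<open>m - n\<close> are twice differences of two effect vectors each, and their norms add up to
  at most twice the total weight 1. The offsets \<open>e\<close> and \<open>f\<close> are the biases
  of the two observables.\<close>

lemma joint_measurement:
  assumes S: "valid_strategy S" and x: "\<And>x. alice S x = bloch_state (r x)"
  obtains e f :: real and m n :: "complex \<times> real"
  where "norm (m + n) + norm (m - n) \<le> 2"
    "\<And>b x. (\<Sum>c\<in>UNIV. behaviour S b c x y z) = (1 + bit_sign b * (e + m \<bullet> r x)) / 2"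
    "\<And>c x. (\<Sum>b\<in>UNIV. behaviour S b c x y z) = (1 + bit_sign c * (f + n \<bullet> r x)) / 2"
proof -
  have "\<exists>\<mu> v. norm (v :: complex \<times> real) \<le> \<mu> \<and> (\<forall>r. Re (trace (bob S y b (bloch_state r) ** charlie S z c)) = \<mu> + v \<bullet> r)" for b c
    using behaviour_bloch[OF S, of y b z c] by metis
  then obtain \<mu> and v :: "bool \<Rightarrow> bool \<Rightarrow> complex \<times> real" where v: "\<And>b c. norm (v b c) \<le> \<mu> b c"
    and W: "\<And>b c r. Re (trace (bob S y b (bloch_state r) ** charlie S z c)) = \<mu> b c + v b c \<bullet> r"
    by metis
  have tot: "(\<Sum>b\<in>UNIV. \<Sum>c\<in>UNIV. \<mu> b c + v b c \<bullet> r) = 1" for r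
  proof -
    define X where "X b = bob S y b (bloch_state r)" for b
    have "(\<Sum>b\<in>UNIV. \<Sum>c\<in>UNIV. \<mu> b c + v b c \<bullet> r) =
        Re (trace (X False ** (charlie S z False + charlie S z True))) +
        Re (trace (X True ** (charlie S z False + charlie S z True)))"
      unfolding W[symmetric] by (simp add: UNIV_bool X_def matrix_add_ldistrib trace_add)
    also have "charlie S z False + charlie S z True = mat 1"
      using S by (simp add: valid_strategy_def povm_def)
    also have "Re (trace (X False ** mat 1)) + Re (trace (X True ** mat 1)) = Re (trace (X False + X True))"
      by (simp add: trace_add)
    also have "trace (X False + X True) = 1"
      using S by (simp add: X_def valid_strategy_def instrument_def trace_preserving_def trace_bloch_state)
    finally show ?thesis by simp
  qed
  \<comment> \<open>The state \<open>r = 0\<close> isolates the weights, which sum to 1; what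
    remains says that the effect vectors sum to zero.\<close>
  have mu: "\<mu> True True = 1 - \<mu> False False - \<mu> False True - \<mu> True False"
    using tot[of 0] by (simp add: UNIV_bool)
  have vr: "v True True \<bullet> r = - v False False \<bullet> r - v False True \<bullet> r - v True False \<bullet> r" for r
    using tot[of r] by (simp add: UNIV_bool mu)
  define m where "m = v False False + v False True - v True False - v True True"
  define n where "n = v False False - v False True + v True False - v True True"
  define e where "e = \<mu> False False + \<mu> False True - \<mu> True False - \<mu> True True"
  define f where "f = \<mu> False False - \<mu> False True + \<mu> True False - \<mu> True True"
  show thesis
  proof
    have "m + n = 2 *\<^sub>R (v False False - v True True)" "m - n = 2 *\<^sub>R (v False True - v True False)"
      by (simp_all add: m_def n_def scaleR_2)
    then show "norm (m + n) + norm (m - n) \<le> 2"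
      using norm_triangle_ineq4[of "v False False" "v True True"]
        norm_triangle_ineq4[of "v False True" "v True False"]
        v[of False False] v[of False True] v[of True False] v[of True True] mu
      by simp
    show "(\<Sum>c\<in>UNIV. behaviour S b c x y z) = (1 + bit_sign b * (e + m \<bullet> r x)) / 2" for b x
      by (cases b) (simp_all add: behaviour_def assms(2) W UNIV_bool bit_sign_def e_def m_def
          inner_diff_left inner_add_left vr mu)
    show "(\<Sum>b\<in>UNIV. behaviour S b c x y z) = (1 + bit_sign c * (f + n \<bullet> r x)) / 2" for c x
      by (cases c) (simp_all add: behaviour_def assms(2) W UNIV_bool bit_sign_def f_def n_def
          inner_diff_left inner_add_left vr mu)
  qed
qed

section \<open>Inequalities for jointly measurable observables\<close>

text \<open>Twice the left-hand side is \<open>m + n\<close> paired with \<open>s p + t q\<close>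
  plus \<open>m - n\<close> paired with \<open>s p - t q\<close>. The squared norms of these two
  combinations differ only in the sign of the cross term, so taking its absolute value bounds
  both.\<close>

lemma joint_measurability_tradeoff:
  fixes m n p q :: "'a::real_inner"
  assumes "norm (m + n) + norm (m - n) \<le> 2"
  shows "s * (m \<bullet> p) + t * (n \<bullet> q)
    \<le> sqrt (s\<^sup>2 * (norm p)\<^sup>2 + t\<^sup>2 * (norm q)\<^sup>2 + 2 * \<bar>s * t * (p \<bullet> q)\<bar>)" (is "_ \<le> ?K")
proof -
  have bound: "norm (s *\<^sub>R p + t' *\<^sub>R q) \<le> ?K" if "t' = t \<or> t' = - t" for t'
  proof (rule real_le_rsqrt)
    have "(norm (s *\<^sub>R p + t' *\<^sub>R q))\<^sup>2 = s\<^sup>2 * (norm p)\<^sup>2 + t'\<^sup>2 * (norm q)\<^sup>2 + 2 * (s * t' * (p \<bullet> q))"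
      unfolding power2_norm_eq_inner
      by (simp add: inner_add_left inner_add_right inner_commute power2_eq_square algebra_simps)
    then show "(norm (s *\<^sub>R p + t' *\<^sub>R q))\<^sup>2 \<le> s\<^sup>2 * (norm p)\<^sup>2 + t\<^sup>2 * (norm q)\<^sup>2 + 2 * \<bar>s * t * (p \<bullet> q)\<bar>"
      using that by auto
  qed
  have K: "0 \<le> ?K" by simp
  have "2 * (s * (m \<bullet> p) + t * (n \<bullet> q)) = (m + n) \<bullet> (s *\<^sub>R p + t *\<^sub>R q) + (m - n) \<bullet> (s *\<^sub>R p + (- t) *\<^sub>R q)"
    by (simp add: inner_add_left inner_add_right inner_diff_left inner_diff_right algebra_simps)
  also have "\<dots> \<le> norm (m + n) * ?K + norm (m - n) * ?K"
    by (intro add_mono order_trans[OF norm_cauchy_schwarz] mult_left_mono bound) simp_all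
  also have "\<dots> = (norm (m + n) + norm (m - n)) * ?K" by (simp only: distrib_right)
  also have "\<dots> \<le> 2 * ?K" using assms K by (rule mult_right_mono)
  finally show ?thesis by simp
qed

lemma add_le_sqrt_2_mult:
  fixes a b :: real
  assumes "a\<^sup>2 + b\<^sup>2 \<le> k"
  shows "a + b \<le> sqrt (2 * k)"
proof (rule real_le_rsqrt)
  have "0 \<le> (a - b)\<^sup>2" by simp
  then show "(a + b)\<^sup>2 \<le> 2 * k" using assms by (simp add: power2_sum power2_diff)
qed

text \<open>The indices of \<open>n\<close> are Bob's input and then Charlie's. The pairs
  \<open>(m0, n01)\<close> and \<open>(m1, n10)\<close> come from different bits and together give
  at most \<open>2 * sqrt 2\<close>; \<open>n00\<close> and \<open>n11\<close> contribute the
  remaining \<open>2 * sqrt 2 * t\<close>.\<close>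

lemma sequential_vector_bound:
  fixes d g m0 m1 n00 n01 n10 n11 :: "'a::real_inner" and s t :: real
  defines "p \<equiv> d + g" and "q \<equiv> d - g"
  assumes d: "norm d \<le> 1" and g: "norm g \<le> 1" and st: "s\<^sup>2 + t\<^sup>2 = 1" and t: "0 \<le> t"
    and j0: "norm (m0 + n01) + norm (m0 - n01) \<le> 2"
    and j1: "norm (m1 + n10) + norm (m1 - n10) \<le> 2"
    and n: "norm n00 \<le> 1" "norm n11 \<le> 1"
  shows "s * (m0 \<bullet> p + m1 \<bullet> q) + t * (n00 \<bullet> p + n10 \<bullet> p + n01 \<bullet> q + n11 \<bullet> q) \<le> 2 * sqrt 2 * (1 + t)"
proof -
  define D G where "D = (norm d)\<^sup>2" and "G = (norm g)\<^sup>2"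
  have DG: "D \<le> 1" "G \<le> 1" using d g by (simp_all add: D_def G_def power_le_one)
  have pq: "(norm p)\<^sup>2 + (norm q)\<^sup>2 = 2 * (D + G)" "p \<bullet> q = D - G"
    unfolding p_def q_def D_def G_def power2_norm_eq_inner
    by (simp_all add: inner_add_left inner_add_right inner_diff_left inner_diff_right inner_commute)
  have pq2: "norm p + norm q \<le> 2 * sqrt 2"
    using add_le_sqrt_2_mult[of "norm p" "norm q" 4] pq DG by (simp add: real_sqrt_mult[of 4 2, simplified])
  have "n00 \<bullet> p \<le> norm p" "n11 \<bullet> q \<le> norm q"
    using n by (auto intro!: order_trans[OF norm_cauchy_schwarz] mult_left_le_one_le)
  then have A: "t * (n00 \<bullet> p + n11 \<bullet> q) \<le> t * (2 * sqrt 2)"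
    using pq2 t by (intro mult_left_mono) auto
  define c where "c = 2 * \<bar>s * t * (p \<bullet> q)\<bar>"
  have "2 * \<bar>s * t\<bar> \<le> 1"
    using st sum_squares_bound[of s t] sum_squares_bound[of "-s" t] by (simp add: abs_if)
  then have "(2 * \<bar>s * t\<bar>) * \<bar>D - G\<bar> \<le> 1 * \<bar>D - G\<bar>" by (rule mult_right_mono) simp
  \<comment> \<open>Unequal lengths of \<open>d\<close> and \<open>g\<close> make \<open>p\<close>
    and \<open>q\<close> non-orthogonal, but the gain is compensated:
    \<open>2 * (D + G) + 2 * \<bar>D - G\<bar>\<close> equals \<open>4 * max D G\<close>.\<close>
  then have c: "2 * (D + G) + 2 * c \<le> 4" using DG by (simp add: c_def pq abs_mult)
  have "0 \<le> c" by (simp add: c_def)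
  \<comment> \<open>The weights \<open>s\<^sup>2\<close> and \<open>t\<^sup>2\<close> are swapped
    between \<open>k0\<close> and \<open>k1\<close>, so in the sum each squared norm gets weight
    1.\<close>
  define k0 where "k0 = s\<^sup>2 * (norm p)\<^sup>2 + t\<^sup>2 * (norm q)\<^sup>2 + c"
  define k1 where "k1 = s\<^sup>2 * (norm q)\<^sup>2 + t\<^sup>2 * (norm p)\<^sup>2 + c"
  have "s * (m0 \<bullet> p) + t * (n01 \<bullet> q) \<le> sqrt k0"
    unfolding k0_def c_def by (rule joint_measurability_tradeoff[OF j0])
  moreover have "s * (m1 \<bullet> q) + t * (n10 \<bullet> p) \<le> sqrt k1"
    unfolding k1_def c_def inner_commute[of p q] by (rule joint_measurability_tradeoff[OF j1])
  moreover have "sqrt k0 + sqrt k1 \<le> 2 * sqrt 2"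
  proof -
    have "k0 \<ge> 0" "k1 \<ge> 0" using \<open>0 \<le> c\<close> by (simp_all add: k0_def k1_def)
    moreover have "k0 + k1 = (s\<^sup>2 + t\<^sup>2) * ((norm p)\<^sup>2 + (norm q)\<^sup>2) + 2 * c"
      by (simp add: k0_def k1_def algebra_simps)
    then have "k0 + k1 \<le> 4" using c by (simp add: st pq)
    ultimately show ?thesis
      using add_le_sqrt_2_mult[of "sqrt k0" "sqrt k1" 4] by (simp add: real_sqrt_mult[of 4 2, simplified])
  qed
  ultimately show ?thesis using A by (simp add: algebra_simps)
qed

section \<open>Scores of a strategy without shared randomness\<close>

text \<open>Bob's score is evaluated at Charlie's input \<open>\<not> y\<close>, because the trade-off compares his
  outcome with Charlie's outcome for the other bit.\<close>

definition bob_score :: "strategy \<Rightarrow> real" where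
  "bob_score S = (\<Sum>x\<in>UNIV. \<Sum>y\<in>UNIV. \<Sum>c\<in>UNIV. behaviour S (sel x y) c x y (\<not> y))"

definition charlie_score :: "strategy \<Rightarrow> real" where
  "charlie_score S = (\<Sum>x\<in>UNIV. \<Sum>z\<in>UNIV. \<Sum>y\<in>UNIV. \<Sum>b\<in>UNIV. behaviour S b (sel x z) x y z) / 2"

lemma sum_UNIV_bool_pair:
  "(\<Sum>x\<in>UNIV. h x) = h (False, False) + h (False, True) + h (True, False) + h (True, True)"
  for h :: "bool \<times> bool \<Rightarrow> real"
  unfolding UNIV_Times_UNIV[symmetric] sum.cartesian_product'[symmetric]
  by (simp add: UNIV_bool add.assoc)

lemma score_tradeoff:
  assumes S: "valid_strategy S" and st: "s\<^sup>2 + t\<^sup>2 = 1" "0 \<le> t"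
  shows "s * (bob_score S - 4) / 2 + t * (charlie_score S - 4) \<le> sqrt 2 * (1 + t)"
proof -
  have "\<exists>r. norm r \<le> 1 \<and> alice S x = bloch_state r" for x
    using S density_operator_bloch[of "alice S x"] unfolding valid_strategy_def by metis
  then obtain r where r: "\<And>x. norm (r x) \<le> 1" and x: "\<And>x. alice S x = bloch_state (r x)"
    by metis
  have "\<exists>e f m n. norm (m + n) + norm (m - n) \<le> 2 \<and>
    (\<forall>b x. (\<Sum>c\<in>UNIV. behaviour S b c x y z) = (1 + bit_sign b * (e + m \<bullet> r x)) / 2) \<and>
    (\<forall>c x. (\<Sum>b\<in>UNIV. behaviour S b c x y z) = (1 + bit_sign c * (f + n \<bullet> r x)) / 2)" for y z
    by (rule joint_measurement[OF S x, of y z]) blast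
  then obtain e f m n where j: "\<And>y z. norm (m y z + n y z) + norm (m y z - n y z) \<le> 2"
    and b: "\<And>y z b x. (\<Sum>c\<in>UNIV. behaviour S b c x y z) = (1 + bit_sign b * (e y z + m y z \<bullet> r x)) / 2"
    and c: "\<And>y z c x. (\<Sum>b\<in>UNIV. behaviour S b c x y z) = (1 + bit_sign c * (f y z + n y z \<bullet> r x)) / 2"
    by metis
  have n1: "norm (n y z) \<le> 1" for y z
  proof -
    have "2 *\<^sub>R n y z = (m y z + n y z) - (m y z - n y z)" by (simp add: scaleR_2)
    then have "2 * norm (n y z) \<le> norm (m y z + n y z) + norm (m y z - n y z)"
      using norm_triangle_ineq4[of "m y z + n y z" "m y z - n y z"] by (metis norm_scaleR abs_numeral)
    then show ?thesis using j[of y z] by simp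
  qed
  define d where "d = (1/2) *\<^sub>R (r (False, False) - r (True, True))"
  define g where "g = (1/2) *\<^sub>R (r (False, True) - r (True, False))"
  have "norm d \<le> 1" "norm g \<le> 1"
    unfolding d_def g_def
    using norm_triangle_ineq4[of "r (False, False)" "r (True, True)"] r[of "(False, False)"] r[of "(True, True)"]
      norm_triangle_ineq4[of "r (False, True)" "r (True, False)"] r[of "(False, True)"] r[of "(True, False)"]
    by simp_all
  note bound = sequential_vector_bound[OF this st j[of False True] j[of True False] n1[of False False] n1[of True True]]
  \<comment> \<open>The score 4 is that of random guessing. The biases \<open>e\<close> and
    \<open>f\<close> cancel because each bit is 0 and 1 equally often; the signed sums of Bloch
    vectors for the two bits are \<open>2 (d + g)\<close> and \<open>2 (d - g)\<close>.\<close>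
  have "bob_score S - 4 = m False True \<bullet> (d + g) + m True False \<bullet> (d - g)"
    unfolding bob_score_def b sum_UNIV_bool_pair
    by (simp add: UNIV_bool sel_def bit_sign_def d_def g_def inner_add_right inner_diff_right field_simps)
  moreover have "2 * (charlie_score S - 4) = n False False \<bullet> (d + g) + n True False \<bullet> (d + g)
      + n False True \<bullet> (d - g) + n True True \<bullet> (d - g)"
    unfolding charlie_score_def c sum_UNIV_bool_pair
    by (simp add: UNIV_bool sel_def bit_sign_def d_def g_def inner_add_right inner_diff_right field_simps)
  moreover have "2 * (s * (bob_score S - 4) / 2 + t * (charlie_score S - 4))
      = s * (bob_score S - 4) + t * (2 * (charlie_score S - 4))" by simp
  ultimately have "2 * (s * (bob_score S - 4) / 2 + t * (charlie_score S - 4)) \<le> 2 * sqrt 2 * (1 + t)"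
    using bound by (simp only:)
  then show ?thesis by simp
qed

section \<open>Averaging over the shared randomness\<close>

lemma
  assumes "shared_strategy M S"
  shows integrable_bob_score: "integrable M (\<lambda>r. bob_score (S r))"
    and integrable_charlie_score: "integrable M (\<lambda>r. charlie_score (S r))"
  unfolding bob_score_def charlie_score_def
  by (intro Bochner_Integration.integrable_sum integrable_divide integrable_behaviour[OF assms])+

lemma P_Bob_eq:
  assumes "shared_strategy M S"
  shows "P_Bob M S = (\<integral>r. bob_score (S r) \<partial>M) / 8"
  unfolding P_Bob_def bob_score_def prob_b_eq[OF assms, of _ _ y "\<not> y" for y] prob_bc_def
  by (simp add: Bochner_Integration.integral_sum integrable_behaviour[OF assms] Bochner_Integration.integrable_sum)

lemma P_Charlie_eq:
  assumes "shared_strategy M S"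
  shows "P_Charlie M S = (\<integral>r. charlie_score (S r) \<partial>M) / 8"
  unfolding P_Charlie_def charlie_score_def prob_c_def prob_bc_def
  by (simp add: Bochner_Integration.integral_sum integrable_behaviour[OF assms] Bochner_Integration.integrable_sum
      sum_divide_distrib)

lemma average_tradeoff:
  assumes S: "shared_strategy M S" and st: "s\<^sup>2 + t\<^sup>2 = 1" "0 \<le> t"
  shows "s * (4 * P_Bob M S - 2) + t * (8 * P_Charlie M S - 4) \<le> sqrt 2 * (1 + t)"
proof -
  interpret prob_space M using S by (simp add: shared_strategy_def)
  note int = integrable_bob_score[OF S] integrable_charlie_score[OF S]
  have "(\<integral>r. s * (bob_score (S r) - 4) / 2 + t * (charlie_score (S r) - 4) \<partial>M) \<le> (\<integral>r. sqrt 2 * (1 + t) \<partial>M)"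
  proof (rule integral_mono)
    show "integrable M (\<lambda>r. s * (bob_score (S r) - 4) / 2 + t * (charlie_score (S r) - 4))"
      by (intro Bochner_Integration.integrable_add Bochner_Integration.integrable_diff
          integrable_divide integrable_mult_right integrable_const int)
  qed (use S in \<open>auto intro!: score_tradeoff st simp: shared_strategy_def\<close>)
  then show ?thesis
    using int by (simp add: P_Bob_eq[OF S] P_Charlie_eq[OF S] prob_space field_simps)
qed

section \<open>From the linear inequalities to the curved boundary\<close>

theorem mainTheorem3:
  fixes M :: "'r measure" and S :: "'r \<Rightarrow> strategy"
  assumes "shared_strategy M S"
  shows "P_Charlie M S \<le> 1/2 + 1 / (4 * sqrt 2)
    + sqrt (16 * P_Bob M S * (1 - P_Bob M S) - 2) / 8"
proof -
  define u where "u = 4 * P_Bob M S - 2"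
  define v where "v = 8 * P_Charlie M S - 4 - sqrt 2"
  \<comment> \<open>The shift by \<open>sqrt 2\<close> in \<open>v\<close> absorbs the term
    \<open>sqrt 2 * t\<close>, leaving half-planes tangent to the disc of radius
    \<open>sqrt 2\<close>.\<close>
  have lin: "s * u + t * v \<le> sqrt 2" if "s\<^sup>2 + t\<^sup>2 = 1" "0 \<le> t" for s t
    using average_tradeoff[OF assms that] by (simp add: u_def v_def algebra_simps)
  \<comment> \<open>The horizontal directions make the radicand nonnegative; \<open>sqrt\<close> of
    a negative real would be negative, and the case \<open>v \<le> 0\<close> would fail.\<close>
  have "\<bar>u\<bar> \<le> sqrt 2" using lin[of 1 0] lin[of "-1" 0] by simp
  then have u: "u\<^sup>2 \<le> 2" by (metis abs_le_square_iff real_sqrt_abs real_sqrt_ge_zero abs_of_nonneg real_sqrt_pow2 zero_le_numeral)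
  have "v \<le> sqrt (2 - u\<^sup>2)"
  proof (cases "v \<le> 0")
    case True
    moreover have "0 \<le> sqrt (2 - u\<^sup>2)" using u by simp
    ultimately show ?thesis by linarith
  next
    case False
    \<comment> \<open>The tightest half-plane has its normal along \<open>(u, v)\<close>; it is
      admissible because \<open>v\<close> is positive in this case.\<close>
    define k where "k = sqrt (u\<^sup>2 + v\<^sup>2)"
    have k: "k > 0" "k\<^sup>2 = u\<^sup>2 + v\<^sup>2"
      using False by (simp_all add: k_def add_nonneg_pos)
    have "(u / k)\<^sup>2 + (v / k)\<^sup>2 = 1"
      using k(1) by (simp add: power_divide add_divide_distrib[symmetric] flip: k(2))
    then have "(u / k) * u + (v / k) * v \<le> sqrt 2" using False k by (intro lin) auto
    moreover have "(u / k) * u + (v / k) * v = k\<^sup>2 / k"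
      unfolding k(2) by (simp add: power2_eq_square add_divide_distrib)
    ultimately have "k \<le> sqrt 2" using k(1) by (simp add: power2_eq_square)
    then have "u\<^sup>2 + v\<^sup>2 \<le> 2" by (simp add: k_def)
    then show ?thesis by (intro real_le_rsqrt) simp
  qed
  moreover have "16 * P_Bob M S * (1 - P_Bob M S) - 2 = 2 - u\<^sup>2"
    by (simp add: u_def power2_eq_square algebra_simps)
  moreover have "1 / (4 * sqrt 2) = sqrt 2 / 8"
    by (simp add: field_simps)
  ultimately show ?thesis by (simp add: v_def)
qed

end
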